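(* Let $n\ge 1$, let $a_0,\dots,a_{n-1}\in\mathbb R$, and let $f_s(x)=x^n+a_{n-1}x^{n-1}+\dots+a_1x+a_0$. Let $S$ be the set of all $X\in M_3(\mathbb R)$ satisfying $$X^n+a_{n-1}X^{n-1}+\dots+a_1X+a_0 I=O .$$ Then $S$ is either empty or a disjoint union of the following sets (a set that arises from several choices of the parameters, e.g. $S(J(a,b,c))$ for the permutations of a triple $a,b,c$, is counted once): (1) $S(J(a,b,c))$, whenever $a,b,c$ are distinct real roots of $f_s(x)=0$; (2) $S(J(a,a,b))$, whenever $a,b$ are distinct real roots of $f_s(x)=0$; (3) $S(J_1(a,a,b))$, whenever $a,b$ are distinct real roots of $f_s(x)=0$ and $a$ is a root of multiplicity $\ge 2$; (4) $S(J(a,a,a))$, whenever $a$ is a real root of $f_s(x)=0$; (5) $S(J_1(a,a,a))$, whenever $a$ is a real root of $f_s(x)=0$ of multiplicity $\ge 2$; (6) $S(J_2(a,a,a))$, whenever $a$ is a real root of $f_s(x)=0$ of multiplicity $\ge 3$; (7) $S(J_c(a,p,q))$ with $p,q\in\mathbb R$, $q>0$, whenever $a$ is a real root of $f_s(x)=0$ and $p\pm iq$ are non-real roots of $f_s(x)=0$.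
   Context: $M_3(\mathbb R)$ is the algebra of real $3\times 3$ matrices, $GL_3(\mathbb R)$ the group of invertible ones, $I$ the identity matrix, $O$ the null matrix. For $B\in M_3(\mathbb R)$, $S(B)=\{X^{-1}BX : X\in GL_3(\mathbb R)\}$. For distinct real numbers $a,b,c$ and real numbers $p,q$ with $q\neq 0$: $$J(a,b,c)=\begin{pmatrix} a&0&0\\0&b&0\\0&0&c\end{pmatrix},\quad J(a,a,b)=\begin{pmatrix} a&0&0\\0&a&0\\0&0&b\end{pmatrix},\quad J_1(a,a,b)=\begin{pmatrix} a&1&0\\0&a&0\\0&0&b\end{pmatrix},$$ $$J(a,a,a)=\begin{pmatrix} a&0&0\\0&a&0\\0&0&a\end{pmatrix},\quad J_1(a,a,a)=\begin{pmatrix} a&1&0\\0&a&0\\0&0&a\end{pmatrix},\quad J_2(a,a,a)=\begin{pmatrix} a&1&0\\0&a&1\\0&0&a\end{pmatrix},$$ $$J_c(a,p,q)=\begin{pmatrix} a&0&0\\0&p&q\\0&-q&p\end{pmatrix}.$$ *)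

theory Defs
  imports "HOL-Analysis.Analysis" "HOL-Computational_Algebra.Polynomial"
begin

(* On vectors, hence on matrices, the class operation ^ acts entrywise. *)
primrec matpow :: "real^'n^'n \<Rightarrow> nat \<Rightarrow> real^'n^'n" where
  "matpow X 0 = mat 1"
| "matpow X (Suc k) = X ** matpow X k"

definition sim_class :: "real^3^3 \<Rightarrow> (real^3^3) set" where
  "sim_class B = {matrix_inv X ** B ** X | X. invertible X}"

(* J_diag a b c covers J(a,b,c), J(a,a,b) and J(a,a,a); J_one a b covers
   J_1(a,a,b) and, for b = a, J_1(a,a,a). *)
definition J_diag :: "real \<Rightarrow> real \<Rightarrow> real \<Rightarrow> real^3^3" where
  "J_diag a b c = vector [vector [a, 0, 0], vector [0, b, 0], vector [0, 0, c]]"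

definition J_one :: "real \<Rightarrow> real \<Rightarrow> real^3^3" where
  "J_one a b = vector [vector [a, 1, 0], vector [0, a, 0], vector [0, 0, b]]"

definition J_two :: "real \<Rightarrow> real^3^3" where
  "J_two a = vector [vector [a, 1, 0], vector [0, a, 1], vector [0, 0, a]]"

definition J_cplx :: "real \<Rightarrow> real \<Rightarrow> real \<Rightarrow> real^3^3" where
  "J_cplx a p q = vector [vector [a, 0, 0], vector [0, p, q], vector [0, - q, p]]"

definition monic_poly :: "nat \<Rightarrow> (nat \<Rightarrow> real) \<Rightarrow> real poly" where
  "monic_poly n a = monom 1 n + (\<Sum>k<n. monom (a k) k)"

(* A pair (i, C) records that the similarity class C arises from the i-th kind of
   canonical form. Different parameters of one kind giving the same class yield the
   same pair, so such a class is counted once; classes of different kinds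
   are kept apart by the label. *)
inductive_set listed_classes :: "real poly \<Rightarrow> (nat \<times> (real^3^3) set) set"
  for f :: "real poly" where
  kind1: "poly f a = 0 \<Longrightarrow> poly f b = 0 \<Longrightarrow> poly f c = 0 \<Longrightarrow> a \<noteq> b \<Longrightarrow> a \<noteq> c \<Longrightarrow> b \<noteq> c
    \<Longrightarrow> (1, sim_class (J_diag a b c)) \<in> listed_classes f"
| kind2: "poly f a = 0 \<Longrightarrow> poly f b = 0 \<Longrightarrow> a \<noteq> b
    \<Longrightarrow> (2, sim_class (J_diag a a b)) \<in> listed_classes f"
| kind3: "poly f a = 0 \<Longrightarrow> poly f b = 0 \<Longrightarrow> a \<noteq> b \<Longrightarrow> order a f \<ge> 2
    \<Longrightarrow> (3, sim_class (J_one a b)) \<in> listed_classes f"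
| kind4: "poly f a = 0 \<Longrightarrow> (4, sim_class (J_diag a a a)) \<in> listed_classes f"
| kind5: "poly f a = 0 \<Longrightarrow> order a f \<ge> 2
    \<Longrightarrow> (5, sim_class (J_one a a)) \<in> listed_classes f"
| kind6: "poly f a = 0 \<Longrightarrow> order a f \<ge> 3
    \<Longrightarrow> (6, sim_class (J_two a)) \<in> listed_classes f"
| kind7: "poly f a = 0 \<Longrightarrow> q > 0
    \<Longrightarrow> poly (map_poly complex_of_real f) (Complex p q) = 0
    \<Longrightarrow> poly (map_poly complex_of_real f) (Complex p (- q)) = 0
    \<Longrightarrow> (7, sim_class (J_cplx a p q)) \<in> listed_classes f"

end

theory Submission
  imports Defs
begin

text \<open>
  The solution set of a polynomial matrix equation is a union of similarity classes, since $f(Q B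
  P) = Q f(B) P$ when $P$ and $Q$ are inverse to each other. So it is determined by the canonical
  forms that it contains, and three facts about these forms give the theorem.

  Each form $J$ of the seven kinds has an explicit minimal polynomial $m$, and $f(J) = 0$ holds
  exactly if $m$ divides $f$ (\<open>canonical_annihilator\<close>). The nonzero entries of $f(J)$
  are, up to sign and a factor $1/2$, values of $f$ and of its first two derivatives, or the real
  and imaginary part of $f(p + iq)$; their vanishing is divisibility of $f$ by the corresponding
  product of linear and quadratic factors. The conditions on roots and multiplicities in the list
  say precisely that $m$ divides $f$ (\<open>listed_classes_eq\<close>).

  Every real $3 \times 3$ matrix $X$ is similar to one of the forms
  (\<open>exists_canonical_form\<close>). Either $X$ is scalar, or it is annihilated by a product
  $(x - a)(x - b)$, or by no such product. In the last case the Cayley-Hamilton theorem gives an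
  annihilating monic cubic, and a real cubic has three real roots or one real root and a conjugate
  pair. In each case, vectors that are not killed by a proper factor of the annihilating
  polynomial generate basis vectors of the canonical form; for a quadratic one, these span a
  plane, and a vector outside that plane yields the third.

  Two similarity classes are equal or disjoint, so only classes of different kinds can violate
  disjointness. Similar matrices have the same annihilating polynomials, hence the same minimal
  polynomial, and the minimal polynomial reveals the kind (\<open>canonical_kind_unique\<close>):
  its degree and its number of real roots separate all kinds but the single Jordan block and the
  complex form, and only the latter has non-real roots.

  Both alternatives of the theorem follow from the equation between the solution set and the
  union: if the list is empty, then so is the union.
\<close>

section \<open>Polynomials evaluated at a matrix\<close>

definition mat_poly :: "real poly \<Rightarrow> real^'n^'n \<Rightarrow> real^'n^'n" where
  "mat_poly g X = (\<Sum>k\<le>degree g. coeff g k *\<^sub>R matpow X k)"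

lemmas matrix_scaleR_out = matrix_scalar_ac scalar_matrix_assoc[symmetric]

lemma matrix_add_rdistrib: "((A :: real^'n^'m) + B) ** C = A ** C + B ** (C :: real^'p^'n)"
  by (simp add: matrix_matrix_mult_def vec_eq_iff sum.distrib algebra_simps)

lemma matrix_mul_sum_right: "(A :: real^'n^'m) ** (\<Sum>i\<in>I. B i) = (\<Sum>i\<in>I. A ** (B i :: real^'p^'n))"
  by (induction I rule: infinite_finite_induct) (simp_all add: matrix_add_ldistrib)

text \<open>
  Allows a range of exponents that is fixed in advance, when the exact degree is not known.
\<close>

lemma mat_poly_bound:
  assumes "degree g \<le> n"
  shows "mat_poly g X = (\<Sum>k\<le>n. coeff g k *\<^sub>R matpow X k)"
  unfolding mat_poly_def using assms
  by (intro sum.mono_neutral_left) (auto simp: coeff_eq_0)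

lemma mat_poly_0 [simp]: "mat_poly 0 X = 0"
  by (simp add: mat_poly_def)

text \<open>
  Horner's rule; by induction over the coefficients it reduces an evaluation to one matrix product.
\<close>

lemma mat_poly_pCons: "mat_poly (pCons c g) X = c *\<^sub>R mat 1 + X ** mat_poly g X"
proof -
  have "mat_poly (pCons c g) X = (\<Sum>k\<le>Suc (degree g). coeff (pCons c g) k *\<^sub>R matpow X k)"
    by (rule mat_poly_bound) (simp add: degree_pCons_le)
  also have "\<dots> = c *\<^sub>R mat 1 + (\<Sum>k\<le>degree g. coeff g k *\<^sub>R (X ** matpow X k))"
    by (subst sum.atMost_Suc_shift) simp
  finally show ?thesis
    by (simp add: mat_poly_def matrix_mul_sum_right matrix_scaleR_out)
qed

lemma mat_poly_monic_poly:
  "mat_poly (monic_poly n a) X = matpow X n + (\<Sum>k<n. a k *\<^sub>R matpow X k)"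
proof -
  have c: "coeff (monic_poly n a) k = (if k = n then 1 else if k < n then a k else 0)" for k
    by (simp add: monic_poly_def coeff_sum sum.delta)
  have "degree (monic_poly n a) \<le> n"
    by (rule degree_le) (simp add: c)
  then have "mat_poly (monic_poly n a) X = (\<Sum>k\<le>n. coeff (monic_poly n a) k *\<^sub>R matpow X k)"
    by (rule mat_poly_bound)
  then show ?thesis
    by (simp add: c lessThan_Suc_atMost[symmetric] add.commute)
qed

lemma monic_poly_nonzero: "monic_poly n a \<noteq> 0"
proof -
  have "coeff (monic_poly n a) n = 1"
    by (simp add: monic_poly_def coeff_sum)
  then show ?thesis by auto
qed

section \<open>Similarity classes\<close>

text \<open>
  A pair of mutually inverse matrices avoids the choice hidden in the inverse and makes symmetry
  and transitivity a matter of regrouping products.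
\<close>

lemma sim_class_iff:
  "X \<in> sim_class B \<longleftrightarrow> (\<exists>P Q. P ** Q = mat 1 \<and> Q ** P = mat 1 \<and> X = Q ** B ** P)"
proof
  assume "X \<in> sim_class B"
  then obtain P where P: "invertible P" "X = matrix_inv P ** B ** P"
    by (auto simp: sim_class_def)
  have "P ** matrix_inv P = mat 1 \<and> matrix_inv P ** P = mat 1"
    using P(1) unfolding invertible_def matrix_inv_def by (rule someI_ex)
  with P(2) show "\<exists>P Q. P ** Q = mat 1 \<and> Q ** P = mat 1 \<and> X = Q ** B ** P"
    by blast
next
  assume "\<exists>P Q. P ** Q = mat 1 \<and> Q ** P = mat 1 \<and> X = Q ** B ** P"
  then obtain P Q where PQ: "P ** Q = mat 1" "Q ** P = mat 1" "X = Q ** B ** P"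
    by blast
  then have inv: "invertible P"
    by (auto simp: invertible_def)
  then have R: "P ** matrix_inv P = mat 1 \<and> matrix_inv P ** P = mat 1"
    unfolding invertible_def matrix_inv_def by (rule someI_ex)
  then have "matrix_inv P = Q"
    by (metis PQ(2) matrix_mul_assoc matrix_mul_lid matrix_mul_rid)
  with inv PQ(3) show "X \<in> sim_class B"
    by (auto simp: sim_class_def)
qed

lemma sim_class_sym:
  assumes "X \<in> sim_class B" shows "B \<in> sim_class X"
proof -
  from assms obtain P Q where PQ: "P ** Q = mat 1" "Q ** P = mat 1" "X = Q ** B ** P"
    unfolding sim_class_iff by blast
  have "P ** (Q ** B ** P) ** Q = (P ** Q) ** B ** (P ** Q)"
    by (simp only: matrix_mul_assoc)
  then have "B = P ** X ** Q"
    by (simp add: PQ)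
  then show ?thesis
    unfolding sim_class_iff using PQ by blast
qed

lemma sim_class_trans:
  assumes "X \<in> sim_class Y" "Y \<in> sim_class B" shows "X \<in> sim_class B"
proof -
  from assms obtain P Q P' Q' where
    PQ: "P ** Q = mat 1" "Q ** P = mat 1" "X = Q ** Y ** P" and
    PQ': "P' ** Q' = mat 1" "Q' ** P' = mat 1" "Y = Q' ** B ** P'"
    unfolding sim_class_iff by blast
  have "(P' ** P) ** (Q ** Q') = P' ** (P ** Q) ** Q'"
       "(Q ** Q') ** (P' ** P) = Q ** (Q' ** P') ** P"
    by (simp_all add: matrix_mul_assoc)
  moreover have "X = (Q ** Q') ** B ** (P' ** P)"
    by (simp add: PQ(3) PQ'(3) matrix_mul_assoc)
  ultimately show ?thesis
    unfolding sim_class_iff using PQ PQ' by (metis matrix_mul_rid)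
qed

lemma sim_class_eqI:
  assumes "X \<in> sim_class B" "X \<in> sim_class C" shows "sim_class B = sim_class C"
  using assms sim_class_sym sim_class_trans by blast

lemma mat_poly_conjugate:
  assumes "P ** Q = mat 1" "Q ** P = mat 1"
  shows "mat_poly g (Q ** B ** P) = Q ** mat_poly g B ** P"
proof (induction g)
  case (pCons c g)
  have "Q ** B ** P ** (Q ** mat_poly g B ** P) = Q ** B ** (P ** Q) ** mat_poly g B ** P"
    by (simp add: matrix_mul_assoc)
  then have "Q ** B ** P ** (Q ** mat_poly g B ** P) = Q ** (B ** mat_poly g B) ** P"
    by (simp add: assms(1) matrix_mul_assoc)
  then show ?case
    by (simp add: mat_poly_pCons pCons.IH matrix_add_ldistrib matrix_add_rdistrib
        matrix_scaleR_out assms(2))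
qed simp

text \<open>
  Membership in the solution set, and the whole set of annihilating polynomials, is
  a similarity invariant.
\<close>

lemma mat_poly_similar_zero:
  assumes "X \<in> sim_class B"
  shows "mat_poly g X = 0 \<longleftrightarrow> mat_poly g B = 0"
proof -
  have imp: "mat_poly g X = 0" if "mat_poly g B = 0" "X \<in> sim_class B" for X B
    using that by (auto simp: sim_class_iff mat_poly_conjugate)
  show ?thesis
    using imp assms sim_class_sym by blast
qed

section \<open>Polynomials evaluated at the canonical forms\<close>

lemma mat_poly_J_diag:
  "mat_poly g (J_diag a b c) = J_diag (poly g a) (poly g b) (poly g c)"
proof (induction g)
  case 0
  show ?case by (simp add: J_diag_def vec_eq_iff forall_3)
next
  case (pCons d g)
  then show ?case
    by (simp add: mat_poly_pCons J_diag_def vec_eq_iff forall_3 matrix_matrix_mult_def sum_3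
        mat_def)
qed

lemma mat_poly_J_one:
  "mat_poly g (J_one a b) =
    vector [vector [poly g a, poly (pderiv g) a, 0], vector [0, poly g a, 0],
      vector [0, 0, poly g b]]"
proof (induction g)
  case 0
  show ?case by (simp add: vec_eq_iff forall_3)
next
  case (pCons d g)
  then show ?case
    by (simp add: mat_poly_pCons J_one_def vec_eq_iff forall_3 matrix_matrix_mult_def sum_3
        mat_def pderiv_pCons)
qed

text \<open>
  The entries of a row are the Taylor coefficients of the polynomial at the eigenvalue, since
  the form is $a I + N$ with $N$ nilpotent.
\<close>

lemma mat_poly_J_two:
  "mat_poly g (J_two a) =
    vector [vector [poly g a, poly (pderiv g) a, poly (pderiv (pderiv g)) a / 2],
      vector [0, poly g a, poly (pderiv g) a], vector [0, 0, poly g a]]"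
proof (induction g)
  case 0
  show ?case by (simp add: vec_eq_iff forall_3)
next
  case (pCons d g)
  then show ?case
    by (simp add: mat_poly_pCons J_two_def vec_eq_iff forall_3 matrix_matrix_mult_def sum_3
        mat_def pderiv_pCons pderiv_add field_simps)
qed

text \<open>
  The lower right block represents $p + iq$ under the embedding of the complex numbers
  into the real $2 \times 2$ matrices, which is a ring homomorphism.
\<close>

lemma mat_poly_J_cplx:
  "mat_poly g (J_cplx a p q) =
    J_cplx (poly g a) (Re (poly (map_poly of_real g) (Complex p q)))
      (Im (poly (map_poly of_real g) (Complex p q)))"
proof (induction g)
  case 0
  show ?case by (simp add: J_cplx_def vec_eq_iff forall_3)
next
  case (pCons d g)
  then show ?case
    by (simp add: mat_poly_pCons J_cplx_def vec_eq_iff forall_3 matrix_matrix_mult_def sum_3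
        mat_def map_poly_pCons)
qed

lemma mat_poly_J_diag_eq_0_iff:
  "mat_poly g (J_diag a b c) = 0 \<longleftrightarrow> poly g a = 0 \<and> poly g b = 0 \<and> poly g c = 0"
  unfolding mat_poly_J_diag
  by (auto simp: J_diag_def vec_eq_iff forall_3)

lemma mat_poly_J_one_eq_0_iff:
  "mat_poly g (J_one a b) = 0 \<longleftrightarrow> poly g a = 0 \<and> poly (pderiv g) a = 0 \<and> poly g b = 0"
  unfolding mat_poly_J_one
  by (auto simp: vec_eq_iff forall_3)

lemma mat_poly_J_two_eq_0_iff:
  "mat_poly g (J_two a) = 0 \<longleftrightarrow>
    poly g a = 0 \<and> poly (pderiv g) a = 0 \<and> poly (pderiv (pderiv g)) a = 0"
  unfolding mat_poly_J_two
  by (auto simp: vec_eq_iff forall_3)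

lemma mat_poly_J_cplx_eq_0_iff:
  "mat_poly g (J_cplx a p q) = 0 \<longleftrightarrow>
    poly g a = 0 \<and> poly (map_poly complex_of_real g) (Complex p q) = 0"
  unfolding mat_poly_J_cplx
  by (auto simp: J_cplx_def vec_eq_iff forall_3 complex_eq_iff)

section \<open>Canonical forms and their minimal polynomials\<close>

text \<open>
  Constants for the irreducible real factors keep the products below from being multiplied out
  into coefficient lists by the simplifier.
\<close>

definition lin :: "real \<Rightarrow> real poly" where
  "lin a = [:-a, 1:]"

text \<open>
  The monic real polynomial with the roots $p + iq$ and $p - iq$.
\<close>

definition quad :: "real \<Rightarrow> real \<Rightarrow> real poly" where
  "quad p q = [:p\<^sup>2 + q\<^sup>2, -2 * p, 1:]"

lemma lin_simps [simp]:
  "poly (lin a) x = x - a" "pderiv (lin a) = 1" "degree (lin a) = 1" "lin a \<noteq> 0"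
  "coeff (lin a) (Suc 0) = 1" "poly (map_poly complex_of_real (lin a)) z = z - of_real a"
  by (simp_all add: lin_def pderiv_pCons map_poly_pCons)

lemma quad_simps [simp]:
  "poly (quad p q) x = (x - p)\<^sup>2 + q\<^sup>2" "degree (quad p q) = 2" "quad p q \<noteq> 0"
  "coeff (quad p q) 2 = 1"
  "poly (map_poly complex_of_real (quad p q)) z = (z - of_real p)\<^sup>2 + of_real (q\<^sup>2)"
  by (simp_all add: quad_def eval_nat_numeral map_poly_pCons power2_eq_square algebra_simps)

lemma lin_dvd_iff: "lin a dvd f \<longleftrightarrow> poly f a = 0"
  by (simp add: lin_def poly_eq_0_iff_dvd)

text \<open>
  The third argument is the minimal polynomial of the form, which is proved in
  \<open>canonical_annihilator\<close>. Carrying it along reduces the side conditions of all kinds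
  to one divisibility.
\<close>

inductive canonical :: "nat \<Rightarrow> real^3^3 \<Rightarrow> real poly \<Rightarrow> bool" where
  canonical1: "a \<noteq> b \<Longrightarrow> a \<noteq> c \<Longrightarrow> b \<noteq> c
    \<Longrightarrow> canonical 1 (J_diag a b c) (lin a * lin b * lin c)"
| canonical2: "a \<noteq> b \<Longrightarrow> canonical 2 (J_diag a a b) (lin a * lin b)"
| canonical3: "a \<noteq> b \<Longrightarrow> canonical 3 (J_one a b) ((lin a)\<^sup>2 * lin b)"
| canonical4: "canonical 4 (J_diag a a a) (lin a)"
| canonical5: "canonical 5 (J_one a a) ((lin a)\<^sup>2)"
| canonical6: "canonical 6 (J_two a) (lin a ^ 3)"
| canonical7: "q > 0 \<Longrightarrow> canonical 7 (J_cplx a p q) (lin a * quad p q)"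

text \<open>
  A new root splits off from the cofactor of \<open>m\<close>, because it is not a root of \<open>m\<close> itself.
\<close>

lemma mult_linear_dvd_iff:
  fixes m f :: "real poly"
  assumes "poly m b \<noteq> 0"
  shows "m * lin b dvd f \<longleftrightarrow> m dvd f \<and> poly f b = 0"
proof
  assume "m * lin b dvd f"
  then obtain k where "f = m * (lin b * k)"
    by (metis dvdE mult.assoc)
  then show "m dvd f \<and> poly f b = 0"
    by simp
next
  assume R: "m dvd f \<and> poly f b = 0"
  then obtain h where h: "f = m * h" by (auto elim: dvdE)
  with R assms have "lin b dvd h"
    by (simp add: lin_dvd_iff)
  then show "m * lin b dvd f"
    by (simp add: h mult_dvd_mono)
qed

lemma square_dvd_iff:
  fixes f :: "real poly"
  shows "(lin a)\<^sup>2 dvd f \<longleftrightarrow> poly f a = 0 \<and> poly (pderiv f) a = 0"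
proof
  assume "(lin a)\<^sup>2 dvd f"
  then show "poly f a = 0 \<and> poly (pderiv f) a = 0"
    by (auto elim!: dvdE simp: pderiv_mult pderiv_power_Suc power2_eq_square)
next
  assume R: "poly f a = 0 \<and> poly (pderiv f) a = 0"
  then obtain h where h: "f = lin a * h"
    by (meson lin_dvd_iff dvdE)
  with R have "poly h a = 0"
    by (auto simp: pderiv_mult pderiv_pCons)
  then show "(lin a)\<^sup>2 dvd f"
    by (simp add: h power2_eq_square lin_dvd_iff mult_dvd_mono)
qed

text \<open>
  If $f = (x - a)^2 h$, then $f''(a) = 2 h(a)$, so the second derivative tests for a third factor.
\<close>

lemma cube_dvd_iff:
  fixes f :: "real poly"
  shows "lin a ^ 3 dvd f \<longleftrightarrow>
    poly f a = 0 \<and> poly (pderiv f) a = 0 \<and> poly (pderiv (pderiv f)) a = 0"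
proof -
  have eq: "poly (pderiv (pderiv f)) a = 2 * poly h a" if "f = (lin a)\<^sup>2 * h" for h
    by (simp add: that pderiv_mult pderiv_add power2_eq_square algebra_simps)
  show ?thesis
  proof
    assume "lin a ^ 3 dvd f"
    then obtain h where h: "f = (lin a)\<^sup>2 * (lin a * h)"
      by (auto simp: power3_eq_cube power2_eq_square mult.assoc elim: dvdE)
    then have "(lin a)\<^sup>2 dvd f" by (metis dvd_triv_left)
    then show "poly f a = 0 \<and> poly (pderiv f) a = 0 \<and> poly (pderiv (pderiv f)) a = 0"
      using eq[OF h] by (simp add: square_dvd_iff)
  next
    assume R: "poly f a = 0 \<and> poly (pderiv f) a = 0 \<and> poly (pderiv (pderiv f)) a = 0"
    then obtain h where h: "f = (lin a)\<^sup>2 * h"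
      by (meson square_dvd_iff dvdE)
    then have "lin a dvd h"
      using R eq[OF h] by (simp add: lin_dvd_iff)
    then have "(lin a)\<^sup>2 * lin a dvd f"
      unfolding h by (rule mult_dvd_mono[OF dvd_refl])
    then show "lin a ^ 3 dvd f"
      by (simp only: power3_eq_cube power2_eq_square mult.assoc)
  qed
qed

lemma map_poly_of_real_mult:
  "map_poly complex_of_real (g * h) = map_poly of_real g * map_poly of_real h"
  by (intro poly_eqI) (simp add: coeff_map_poly coeff_mult)

text \<open>
  The remainder modulo the quadratic is a real polynomial $c + d x$. If it vanishes at the non-real
  number $p + iq$, then the imaginary part gives $d = 0$ and the real part $c = 0$.
\<close>

lemma quadratic_dvd_iff:
  fixes f :: "real poly"
  assumes "q \<noteq> 0"
  shows "quad p q dvd f \<longleftrightarrow>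
    poly (map_poly complex_of_real f) (Complex p q) = 0"
proof -
  let ?m = "quad p q"
  have root: "poly (map_poly complex_of_real (?m * h)) (Complex p q) = 0" for h
    unfolding map_poly_of_real_mult poly_mult
    by (simp add: map_poly_pCons complex_eq_iff power2_eq_square algebra_simps)
  show ?thesis
  proof
    assume "?m dvd f"
    then show "poly (map_poly complex_of_real f) (Complex p q) = 0"
      using root by (auto elim: dvdE)
  next
    assume z: "poly (map_poly complex_of_real f) (Complex p q) = 0"
    define r where "r = f mod ?m"
    have "degree r < 2"
      using degree_mod_less'[of ?m f] quad_simps(2,3)[of p q] by (cases "r = 0") (auto simp: r_def)
    then have "r = [:coeff r 0, coeff r 1:]"
      by (intro poly_eqI) (auto simp: coeff_pCons coeff_eq_0 split: nat.splits)
    then obtain c d where r: "r = [:c, d:]" by blast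
    have "f = ?m * (f div ?m) + r"
      unfolding r_def by (rule mult_div_mod_eq[symmetric])
    then have "poly (map_poly complex_of_real (?m * (f div ?m) + r)) (Complex p q) = 0"
      using z by metis
    moreover have "map_poly complex_of_real (?m * (f div ?m) + r) =
        map_poly of_real (?m * (f div ?m)) + map_poly of_real r"
      by (intro poly_eqI) (simp add: coeff_map_poly)
    ultimately have "poly (map_poly complex_of_real r) (Complex p q) = 0"
      using root by simp
    then have "c = 0 \<and> d = 0"
      using assms by (auto simp: r map_poly_pCons complex_eq_iff)
    then show "?m dvd f"
      using r by (simp add: r_def mod_eq_0_iff_dvd)
  qed
qed

lemma linear_quadratic_dvd_iff:
  fixes f :: "real poly"
  assumes "q \<noteq> 0"
  shows "lin a * quad p q dvd f \<longleftrightarrow>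
    poly f a = 0 \<and> poly (map_poly complex_of_real f) (Complex p q) = 0"
proof -
  have "poly (quad p q) a \<noteq> 0"
    using assms by (simp add: sum_power2_eq_zero_iff)
  then show ?thesis
    using assms by (simp add: mult.commute[of "lin a"] mult_linear_dvd_iff quadratic_dvd_iff conj_commute)
qed

text \<open>
  The entries of \<open>mat_poly g J\<close> are exactly the quantities whose vanishing characterises
  divisibility by \<open>m\<close>; hence \<open>m\<close> is the minimal polynomial of \<open>J\<close>.
\<close>

lemma canonical_annihilator:
  assumes "canonical i J m"
  shows "mat_poly g J = 0 \<longleftrightarrow> m dvd g"
  using assms
proof cases
  case (canonical1 a b c)
  then show ?thesis
    by (auto simp: mat_poly_J_diag_eq_0_iff mult_linear_dvd_iff lin_dvd_iff)
next
  case (canonical2 a b)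
  then show ?thesis
    by (auto simp: mat_poly_J_diag_eq_0_iff mult_linear_dvd_iff lin_dvd_iff)
next
  case (canonical3 a b)
  then show ?thesis
    by (auto simp: mat_poly_J_one_eq_0_iff mult_linear_dvd_iff square_dvd_iff)
next
  case (canonical4 a)
  then show ?thesis
    by (auto simp: mat_poly_J_diag_eq_0_iff lin_dvd_iff)
next
  case (canonical5 a)
  then show ?thesis
    by (auto simp: mat_poly_J_one_eq_0_iff square_dvd_iff)
next
  case (canonical6 a)
  then show ?thesis
    by (auto simp: mat_poly_J_two_eq_0_iff cube_dvd_iff)
next
  case (canonical7 q a p)
  then show ?thesis
    by (auto simp: mat_poly_J_cplx_eq_0_iff linear_quadratic_dvd_iff)
qed

text \<open>
  The conditions on roots and multiplicities in all seven kinds are instances of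
  the one condition that the minimal polynomial divides \<open>f\<close>.
\<close>

lemma listed_classes_eq:
  assumes "f \<noteq> 0"
  shows "listed_classes f = {(i, sim_class J) | i J. \<exists>m. canonical i J m \<and> m dvd f}"
proof (intro equalityI subsetI)
  have order: "lin a ^ k dvd f \<longleftrightarrow> k \<le> order a f" for a k
    using assms by (simp add: order_divides lin_def)
  fix d assume "d \<in> listed_classes f"
  then obtain i C where d: "d = (i, C)" "(i, C) \<in> listed_classes f"
    by (cases d) simp
  from d(2) have "\<exists>J m. C = sim_class J \<and> canonical i J m \<and> m dvd f"
  proof cases
    case (kind1 a b c)
    then have "lin a * lin b * lin c dvd f"
      by (simp add: mult_linear_dvd_iff lin_dvd_iff)
    then show ?thesis
      unfolding kind1(1,2) using canonical1[OF kind1(6-8)] by blast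
  next
    case (kind2 a b)
    then have "lin a * lin b dvd f"
      by (simp add: mult_linear_dvd_iff lin_dvd_iff)
    then show ?thesis
      unfolding kind2(1,2) using canonical2[OF kind2(5)] by blast
  next
    case (kind3 a b)
    then have "(lin a)\<^sup>2 * lin b dvd f"
      by (simp add: mult_linear_dvd_iff order)
    then show ?thesis
      unfolding kind3(1,2) using canonical3[OF kind3(5)] by blast
  next
    case (kind4 a)
    then have "lin a dvd f"
      by (simp add: lin_dvd_iff)
    then show ?thesis
      unfolding kind4(1,2) using canonical4 by blast
  next
    case (kind5 a)
    then have "(lin a)\<^sup>2 dvd f"
      by (simp add: order)
    then show ?thesis
      unfolding kind5(1,2) using canonical5 by blast
  next
    case (kind6 a)
    then have "lin a ^ 3 dvd f"
      by (simp add: order)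
    then show ?thesis
      unfolding kind6(1,2) using canonical6 by blast
  next
    case (kind7 a q p)
    then have "lin a * quad p q dvd f"
      by (simp add: linear_quadratic_dvd_iff)
    then show ?thesis
      unfolding kind7(1,2) using canonical7[OF kind7(4)] by blast
  qed
  then show "d \<in> {(i, sim_class J) | i J. \<exists>m. canonical i J m \<and> m dvd f}"
    unfolding d(1) by blast
next
  have order: "lin a ^ k dvd f \<longleftrightarrow> k \<le> order a f" for a k
    using assms by (simp add: order_divides lin_def)
  fix d assume "d \<in> {(i, sim_class J) | i J. \<exists>m. canonical i J m \<and> m dvd f}"
  then obtain i J m where d: "d = (i, sim_class J)" and J: "canonical i J m" and m: "m dvd f"
    by blast
  from J show "d \<in> listed_classes f"
  proof cases
    case (canonical1 a b c)
    with m show ?thesis unfolding d canonical1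
      by (intro listed_classes.kind1)
        (simp_all add: mult_linear_dvd_iff lin_dvd_iff)
  next
    case (canonical2 a b)
    with m show ?thesis unfolding d canonical2
      by (intro listed_classes.kind2)
        (simp_all add: mult_linear_dvd_iff lin_dvd_iff)
  next
    case (canonical3 a b)
    with m have "(lin a)\<^sup>2 dvd f" "poly f b = 0"
      by (simp_all add: mult_linear_dvd_iff)
    with canonical3 show ?thesis unfolding d canonical3
      by (intro listed_classes.kind3) (simp_all add: order[symmetric] square_dvd_iff)
  next
    case (canonical4 a)
    with m show ?thesis unfolding d canonical4
      by (intro listed_classes.kind4) (simp add: lin_dvd_iff)
  next
    case (canonical5 a)
    with m show ?thesis unfolding d canonical5
      by (intro listed_classes.kind5) (simp_all add: order[symmetric] square_dvd_iff)
  next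
    case (canonical6 a)
    with m show ?thesis unfolding d canonical6
      by (intro listed_classes.kind6) (simp_all add: order[symmetric] cube_dvd_iff)
  next
    case (canonical7 q a p)
    then have q: "q \<noteq> 0" "- q \<noteq> 0" by simp_all
    then have "poly f a = 0" "poly (map_poly complex_of_real f) (Complex p q) = 0"
      using m canonical7 linear_quadratic_dvd_iff[OF q(1), of a p f] by simp_all
    \<comment> \<open>The conjugate number has the same real quadratic, so it is a root as well.\<close>
    moreover from this have "poly (map_poly complex_of_real f) (Complex p (- q)) = 0"
      using quadratic_dvd_iff[OF q(1), of p f] quadratic_dvd_iff[OF q(2), of p f]
      by (simp add: quad_def)
    ultimately show ?thesis
      using canonical7 unfolding d canonical7 by (intro listed_classes.kind7) simp_all
  qed
qed

section \<open>The minimal polynomial determines the kind\<close>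

lemma canonical_monic:
  assumes "canonical i J m" shows "lead_coeff m = 1"
  using assms by cases (simp_all add: lead_coeff_mult lead_coeff_power)

lemma canonical_degree:
  assumes "canonical i J m"
  shows "degree m = (if i = 4 then 1 else if i \<in> {2, 5} then 2 else 3)"
  using assms
  by cases (simp_all add: degree_mult_eq degree_power_eq)

lemma canonical_card_roots:
  assumes "canonical i J m"
  shows "card {x. poly m x = 0} = (if i = 1 then 3 else if i \<in> {2, 3} then 2 else 1)"
  using assms
proof cases
  case (canonical1 a b c)
  then have "{x. poly m x = 0} = {a, b, c}" by auto
  with canonical1 show ?thesis by simp
next
  case (canonical2 a b)
  then have "{x. poly m x = 0} = {a, b}" by auto
  with canonical2 show ?thesis by simp
next
  case (canonical3 a b)
  then have "{x. poly m x = 0} = {a, b}" by auto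
  with canonical3 show ?thesis by simp
next
  case (canonical4 a)
  then have "{x. poly m x = 0} = {a}" by auto
  with canonical4 show ?thesis by simp
next
  case (canonical5 a)
  then have "{x. poly m x = 0} = {a}" by auto
  with canonical5 show ?thesis by simp
next
  case (canonical6 a)
  then have "{x. poly m x = 0} = {a}" by auto
  with canonical6 show ?thesis by simp
next
  case (canonical7 q a p)
  then have "{x. poly m x = 0} = {a}"
    by (auto simp: sum_power2_eq_zero_iff)
  with canonical7 show ?thesis by simp
qed

text \<open>
  These two kinds agree in degree and number of real roots, but the cube of a real linear
  factor has no non-real root.
\<close>

lemma canonical_6_7_disjoint:
  assumes "canonical 6 J m" shows "\<not> canonical 7 J' m"
proof
  assume "canonical 7 J' m"
  then obtain b p q where m7: "m = lin b * quad p q" and "q > 0"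
    by cases auto
  from assms obtain a where m6: "m = lin a ^ 3"
    by cases auto
  have "poly (map_poly complex_of_real m) (Complex p q) = 0"
    using linear_quadratic_dvd_iff[of q b p m] m7 \<open>q > 0\<close> by simp
  then have "(Complex p q - of_real a) ^ 3 = 0"
    by (simp add: m6 power3_eq_cube map_poly_of_real_mult map_poly_pCons)
  then show False
    using \<open>q > 0\<close> unfolding power_eq_0_iff by (simp add: complex_eq_iff)
qed

lemma canonical_kind_unique:
  assumes "canonical i J m" "canonical j J' m" shows "i = j"
proof -
  have range: "k = 1 \<or> k = 2 \<or> k = 3 \<or> k = 4 \<or> k = 5 \<or> k = 6 \<or> k = 7"
    if "canonical k K m" for k K
    using that by cases simp_all
  have no67: "\<not> (i = 6 \<and> j = 7)" "\<not> (i = 7 \<and> j = 6)"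
    using assms canonical_6_7_disjoint by metis+
  define d c where "d = degree m" "c = card {x. poly m x = 0}"
  have dc: "d = (if k = 4 then 1 else if k \<in> {2, 5} then 2 else 3)"
    "c = (if k = 1 then 3 else if k \<in> {2, 3} then 2 else 1)" if "canonical k K m" for k K
    unfolding d_c_def using canonical_degree[OF that] canonical_card_roots[OF that] .
  show ?thesis
    using range[OF assms(1)] range[OF assms(2)] dc[OF assms(1)] dc[OF assms(2)] no67
    by (elim disjE) simp_all
qed

lemma monic_dvd_antisym:
  fixes m m' :: "real poly"
  assumes "m dvd m'" "m' dvd m" "lead_coeff m = 1" "lead_coeff m' = 1"
  shows "m = m'"
proof -
  obtain k where k: "m' = m * k" using assms(1) by (rule dvdE)
  have nz: "m \<noteq> 0" "m' \<noteq> 0" using assms(3,4) by auto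
  then have "degree m' \<le> degree m" using assms(2) by (simp add: dvd_imp_degree_le)
  then have "degree k = 0" using nz k by (simp add: degree_mult_eq)
  moreover have "lead_coeff k = 1" using assms(3,4) unfolding k lead_coeff_mult by simp
  ultimately have "k = 1" by (cases k rule: pCons_cases) (auto split: if_splits)
  with k show ?thesis by simp
qed

text \<open>
  A common element makes the two forms similar, so that they have the same annihilating
  polynomials, and therefore the same monic generator of this ideal.
\<close>

lemma canonical_class_kind_unique:
  assumes "canonical i J m" "canonical j J' m'" "X \<in> sim_class J" "X \<in> sim_class J'"
  shows "i = j"
proof -
  have "m dvd g \<longleftrightarrow> m' dvd g" for g
    using canonical_annihilator[OF assms(1), of g] canonical_annihilator[OF assms(2), of g]
      mat_poly_similar_zero[OF assms(3), of g] mat_poly_similar_zero[OF assms(4), of g] by blast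
  from this[of m] this[of m'] have "m dvd m'" "m' dvd m" by simp_all
  then have "m = m'"
    using assms(1,2)[THEN canonical_monic] by (intro monic_dvd_antisym)
  then have "canonical j J' m" using assms(2) by simp
  with assms(1) show ?thesis by (rule canonical_kind_unique)
qed

section \<open>Bases of three-dimensional space\<close>

definition lin_indep3 :: "real^3 \<Rightarrow> real^3 \<Rightarrow> real^3 \<Rightarrow> bool" where
  "lin_indep3 u v w \<longleftrightarrow>
    (\<forall>x y z. x *\<^sub>R u + y *\<^sub>R v + z *\<^sub>R w = 0 \<longrightarrow> x = 0 \<and> y = 0 \<and> z = 0)"

definition columns3 :: "real^3 \<Rightarrow> real^3 \<Rightarrow> real^3 \<Rightarrow> real^3^3" where
  "columns3 u v w = (\<chi> i. vector [u $ i, v $ i, w $ i])"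

lemma columns3_mult_vec: "columns3 u v w *v x = x $ 1 *\<^sub>R u + x $ 2 *\<^sub>R v + x $ 3 *\<^sub>R w"
  by (simp add: columns3_def matrix_vector_mult_def vec_eq_iff sum_3)

lemma lin_indep3_inverse:
  assumes "lin_indep3 u v w"
  obtains Q where "columns3 u v w ** Q = mat 1" "Q ** columns3 u v w = mat 1"
proof -
  have "x = 0" if "columns3 u v w *v x = 0" for x
  proof -
    from that assms have "x $ 1 = 0 \<and> x $ 2 = 0 \<and> x $ 3 = 0"
      unfolding columns3_mult_vec lin_indep3_def by blast
    then show ?thesis by (simp add: vec_eq_iff forall_3)
  qed
  then obtain Q where "Q ** columns3 u v w = mat 1"
    using matrix_left_invertible_ker[of "columns3 u v w"] by blast
  moreover from this have "columns3 u v w ** Q = mat 1"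
    by (simp add: matrix_left_right_inverse)
  ultimately show ?thesis
    using that by blast
qed

lemma lin_indep3_spans:
  assumes "lin_indep3 u v w"
  obtains x y z where "e = x *\<^sub>R u + y *\<^sub>R v + z *\<^sub>R w"
proof -
  from assms obtain Q where "columns3 u v w ** Q = mat 1" "Q ** columns3 u v w = mat 1"
    by (rule lin_indep3_inverse)
  then have "e = columns3 u v w *v (Q *v e)"
    by (simp add: matrix_vector_mul_assoc)
  then show ?thesis
    unfolding columns3_mult_vec by (rule that)
qed

text \<open>
  The hypotheses say that the columns of $B$ are the coordinates of the images of the basis
  vectors, that is, $X P = P B$ for the matrix $P$ whose columns are these vectors.
\<close>

lemma similar_if_basis:
  fixes B :: "real^3^3"
  assumes "lin_indep3 u v w"
    and "X *v u = B$1$1 *\<^sub>R u + B$2$1 *\<^sub>R v + B$3$1 *\<^sub>R w"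
    and "X *v v = B$1$2 *\<^sub>R u + B$2$2 *\<^sub>R v + B$3$2 *\<^sub>R w"
    and "X *v w = B$1$3 *\<^sub>R u + B$2$3 *\<^sub>R v + B$3$3 *\<^sub>R w"
  shows "X \<in> sim_class B"
proof -
  let ?P = "columns3 u v w"
  from assms(1) obtain Q where Q: "?P ** Q = mat 1" "Q ** ?P = mat 1"
    by (rule lin_indep3_inverse)
  have "(X ** ?P) *v e = (?P ** B) *v e" for e
  proof -
    have "(X ** ?P) *v e = X *v (?P *v e)"
      by (simp add: matrix_vector_mul_assoc)
    also have "\<dots> = ?P *v (B *v e)"
      unfolding columns3_mult_vec
      by (simp add: matrix_vector_right_distrib matrix_vector_mult_scaleR assms(2-4)
        matrix_vector_mult_def[of B] sum_3 algebra_simps)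
    finally show ?thesis
      by (simp add: matrix_vector_mul_assoc)
  qed
  then have "X ** ?P = ?P ** B"
    using matrix_eq by blast
  then have "X = ?P ** B ** Q"
    by (metis Q(1) matrix_mul_assoc matrix_mul_rid)
  with Q show ?thesis
    unfolding sim_class_iff by blast
qed

text \<open>
  Supplies the third basis vector when the annihilating polynomial is quadratic and
  only produces two of them.
\<close>

lemma exists_outside_span2:
  fixes u v :: "real^3"
  obtains w where "w \<notin> span {u, v}"
proof -
  have "dim (span {u, v}) \<le> card {u, v}"
    by (simp add: dim_le_card')
  also have "\<dots> < dim (UNIV :: (real^3) set)"
    by (simp add: card_insert_if)
  finally have "span {u, v} \<noteq> UNIV" by (metis less_irrefl)
  then show ?thesis
    using that by blast
qed

lemma lin_indep3_outside_span:
  assumes "\<And>x y. x *\<^sub>R u + y *\<^sub>R v = 0 \<Longrightarrow> x = 0 \<and> y = 0" and "w \<notin> span {u, v}"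
  shows "lin_indep3 u v w"
  unfolding lin_indep3_def
proof (intro allI impI)
  fix x y z assume eq: "x *\<^sub>R u + y *\<^sub>R v + z *\<^sub>R w = 0"
  have "z = 0"
  proof (rule ccontr)
    assume "z \<noteq> 0"
    then have "w = (1 / z) *\<^sub>R (z *\<^sub>R w)"
      by simp
    also have "z *\<^sub>R w = - x *\<^sub>R u - y *\<^sub>R v"
      using eq by (simp add: algebra_simps eq_neg_iff_add_eq_0)
    also have "(1 / z) *\<^sub>R (- x *\<^sub>R u - y *\<^sub>R v) \<in> span {u, v}"
      by (intro span_scale span_diff span_base) auto
    finally show False using assms(2) by simp
  qed
  with eq assms(1) show "x = 0 \<and> y = 0 \<and> z = 0" by simp
qed

lemma lin_indep3_permute:
  assumes "lin_indep3 u v w"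
  shows "lin_indep3 u w v" "lin_indep3 v w u"
proof -
  have indep: "x = 0 \<and> y = 0 \<and> z = 0" if "x *\<^sub>R u + y *\<^sub>R v + z *\<^sub>R w = 0" for x y z
    using assms that unfolding lin_indep3_def by blast
  have "x = 0 \<and> y = 0 \<and> z = 0" if "x *\<^sub>R u + y *\<^sub>R w + z *\<^sub>R v = 0" for x y z
    using indep[of x z y] that by (simp add: add_ac)
  then show "lin_indep3 u w v"
    unfolding lin_indep3_def by blast
  have "x = 0 \<and> y = 0 \<and> z = 0" if "x *\<^sub>R v + y *\<^sub>R w + z *\<^sub>R u = 0" for x y z
    using indep[of z x y] that by (simp add: add_ac)
  then show "lin_indep3 v w u"
    unfolding lin_indep3_def by blast
qed

section \<open>Canonical forms for quadratic annihilating polynomials\<close>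

text \<open>
  The linear operator $X - a I$. Annihilating polynomials are treated in this section and the next
  as compositions of such operators, which commute.
\<close>

definition shift :: "real^3^3 \<Rightarrow> real \<Rightarrow> real^3 \<Rightarrow> real^3" where
  "shift X a v = X *v v - a *\<^sub>R v"

lemma shift_simps:
  "shift X a (u + v) = shift X a u + shift X a v"
  "shift X a (u - v) = shift X a u - shift X a v"
  "shift X a (c *\<^sub>R v) = c *\<^sub>R shift X a v"
  "shift X a 0 = 0"
  by (simp_all add: shift_def matrix_vector_right_distrib matrix_vector_mult_diff_distrib
    matrix_vector_mult_scaleR algebra_simps)

lemma shift_minus: "shift X a (- v) = - shift X a v"
  using shift_simps(3)[of X a "-1" v] by simp

lemma shift_commute: "shift X a (shift X b v) = shift X b (shift X a v)"
  by (simp add: shift_def matrix_vector_right_distrib matrix_vector_mult_diff_distrib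
    matrix_vector_mult_scaleR algebra_simps)

lemma shift_eigen: "shift X a v = 0 \<Longrightarrow> shift X b v = (a - b) *\<^sub>R v"
  by (simp add: shift_def algebra_simps)

lemma mult_vec_shift: "X *v v = a *\<^sub>R v + shift X a v"
  by (simp add: shift_def)

lemma similar_J_diag:
  assumes "lin_indep3 u v w" "shift X a u = 0" "shift X b v = 0" "shift X c w = 0"
  shows "X \<in> sim_class (J_diag a b c)"
  by (rule similar_if_basis[OF assms(1)])
    (simp_all add: J_diag_def mult_vec_shift[of X u a] mult_vec_shift[of X v b]
      mult_vec_shift[of X w c] assms)

lemma similar_J_one:
  assumes "lin_indep3 u v w" "shift X a u = 0" "shift X a v = u" "shift X b w = 0"
  shows "X \<in> sim_class (J_one a b)"
  by (rule similar_if_basis[OF assms(1)])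
    (simp_all add: J_one_def mult_vec_shift[of X u a] mult_vec_shift[of X v a]
      mult_vec_shift[of X w b] assms)

lemma similar_J_two:
  assumes "lin_indep3 u v w" "shift X a u = 0" "shift X a v = u" "shift X a w = v"
  shows "X \<in> sim_class (J_two a)"
  by (rule similar_if_basis[OF assms(1)])
    (simp_all add: J_two_def mult_vec_shift[of X u a] mult_vec_shift[of X v a]
      mult_vec_shift[of X w a] assms)

lemma similar_J_cplx:
  assumes "lin_indep3 u v w" "shift X a u = 0" "shift X p v = - q *\<^sub>R w" "shift X p w = q *\<^sub>R v"
  shows "X \<in> sim_class (J_cplx a p q)"
  by (rule similar_if_basis[OF assms(1)])
    (simp_all add: J_cplx_def mult_vec_shift[of X u a] mult_vec_shift[of X v p]
      mult_vec_shift[of X w p] assms)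

lemma lin_indep2_eigen:
  assumes "a \<noteq> b" "u \<noteq> 0" "v \<noteq> 0" "shift X a u = 0" "shift X b v = 0"
    and eq: "x *\<^sub>R u + y *\<^sub>R v = 0"
  shows "x = 0 \<and> y = 0"
proof -
  have "shift X a (x *\<^sub>R u + y *\<^sub>R v) = 0"
    by (simp only: eq shift_simps)
  then have "y = 0"
    using assms(1-5) shift_eigen[of X b v a] by (simp add: shift_simps)
  with eq assms(2) show ?thesis by simp
qed

text \<open>
  With $a \neq b$, every vector is a combination of $(X - b I) v$ and $(X - a I) v$, which lie in the
  eigenspaces of $a$ and of $b$. Each eigenspace contains a nonzero vector, and together they span
  the three-dimensional space; so one of them contributes two basis vectors. Which one does
  is not determined by the hypotheses, hence the disjunction.
\<close>

lemma canonical_form_split_quadratic: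
  assumes ann: "\<And>v. shift X a (shift X b v) = 0" and "a \<noteq> b"
    and na: "shift X a v0 \<noteq> 0" and nb: "shift X b w0 \<noteq> 0"
  shows "X \<in> sim_class (J_diag a a b) \<or> X \<in> sim_class (J_diag b b a)"
proof -
  define e where "e = shift X b w0"
  define w where "w = shift X a v0"
  have e: "e \<noteq> 0" "shift X a e = 0" using ann nb by (simp_all add: e_def)
  have w: "w \<noteq> 0" "shift X b w = 0"
    using ann na shift_commute[of X b a v0] by (simp_all add: w_def)
  note ind = lin_indep2_eigen[OF \<open>a \<noteq> b\<close> e(1) w(1) e(2) w(2)]
  obtain v where v: "v \<notin> span {e, w}" by (rule exists_outside_span2)
  have "shift X b v - shift X a v = (a - b) *\<^sub>R v"
    by (simp add: shift_def algebra_simps)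
  then have "v = (1 / (a - b)) *\<^sub>R (shift X b v - shift X a v)"
    using \<open>a \<noteq> b\<close> by simp
  also have "\<dots> \<in> span {e, w}"
    if "shift X b v \<in> span {e, w}" "shift X a v \<in> span {e, w}"
    using that by (intro span_scale span_diff)
  finally have "shift X b v \<notin> span {e, w} \<or> shift X a v \<notin> span {e, w}"
    using v by blast
  then show ?thesis
  proof
    assume *: "shift X b v \<notin> span {e, w}"
    have "lin_indep3 e w (shift X b v)"
      by (rule lin_indep3_outside_span[OF _ *]) (use ind in blast)
    then have "lin_indep3 e (shift X b v) w"
      by (rule lin_indep3_permute)
    then show ?thesis
      using similar_J_diag e(2) ann w(2) by blast
  next
    assume *: "shift X a v \<notin> span {e, w}"
    have "lin_indep3 e w (shift X a v)"
      by (rule lin_indep3_outside_span[OF _ *]) (use ind in blast)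
    then have "lin_indep3 w (shift X a v) e"
      by (rule lin_indep3_permute)
    moreover have "shift X b (shift X a v) = 0"
      using ann shift_commute by metis
    ultimately show ?thesis
      using similar_J_diag e(2) w(2) by blast
  qed
qed

text \<open>
  Put $N = X - a I$, so $N^2 = 0$ and $N v \neq 0$. Complete $N v, v$ to a basis by some $e$.
  Applying $N$ to the expansion of $N e$ shows that $N e$ is a multiple of $N v$; subtracting
  that multiple of $v$ from $e$ gives the eigenvector that completes the Jordan basis.
\<close>

lemma canonical_form_square_zero:
  assumes ann: "\<And>v. shift X a (shift X a v) = 0" and n: "shift X a v \<noteq> 0"
  shows "X \<in> sim_class (J_one a a)"
proof -
  let ?u = "shift X a v"
  have ind: "x = 0 \<and> y = 0" if eq: "x *\<^sub>R ?u + y *\<^sub>R v = 0" for x y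
  proof -
    have "shift X a (x *\<^sub>R ?u + y *\<^sub>R v) = 0"
      by (simp only: eq shift_simps)
    then have "y = 0" using n by (simp add: shift_simps ann)
    with eq n show ?thesis by simp
  qed
  obtain e where e: "e \<notin> span {?u, v}" by (rule exists_outside_span2)
  have "lin_indep3 ?u v e"
    by (rule lin_indep3_outside_span[OF _ e]) (use ind in blast)
  then obtain x y z where xyz: "shift X a e = x *\<^sub>R ?u + y *\<^sub>R v + z *\<^sub>R e"
    by (rule lin_indep3_spans)
  have "shift X a (x *\<^sub>R ?u + y *\<^sub>R v + z *\<^sub>R e) = 0"
    by (simp only: xyz[symmetric] ann)
  then have yz: "y *\<^sub>R ?u + z *\<^sub>R shift X a e = 0"
    by (simp add: shift_simps ann)
  \<comment> \<open>If \<open>z = 0\<close>, then \<open>y = 0\<close> by the last equation and the expansion itself has the form required.\<close>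
  have "\<exists>l. shift X a e = l *\<^sub>R ?u"
  proof (cases "z = 0")
    case True
    with yz n xyz show ?thesis by auto
  next
    case False
    then have "shift X a e = (1 / z) *\<^sub>R (z *\<^sub>R shift X a e)" by simp
    also have "z *\<^sub>R shift X a e = (- y) *\<^sub>R ?u"
      using yz by (simp add: eq_neg_iff_add_eq_0 add.commute)
    finally show ?thesis by (metis scaleR_scaleR)
  qed
  then obtain l where l: "shift X a e = l *\<^sub>R ?u" by blast
  have ker: "shift X a (e - l *\<^sub>R v) = 0"
    by (simp add: shift_simps l)
  have "e - l *\<^sub>R v \<notin> span {?u, v}"
  proof
    assume "e - l *\<^sub>R v \<in> span {?u, v}"
    then have "(e - l *\<^sub>R v) + l *\<^sub>R v \<in> span {?u, v}"
      by (intro span_add span_scale span_base[of v]) auto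
    with e show False by simp
  qed
  then have "lin_indep3 ?u v (e - l *\<^sub>R v)"
    by (intro lin_indep3_outside_span) (use ind in blast)
  then show ?thesis
    by (rule similar_J_one) (simp_all add: ann ker)
qed

section \<open>Canonical forms for cubic annihilating polynomials\<close>

text \<open>
  Applying all but one factor of the annihilating polynomial to a suitable vector gives an
  eigenvector for the remaining root.
\<close>

lemma canonical_form_distinct:
  assumes ann: "\<And>v. shift X a (shift X b (shift X c v)) = 0"
    and "a \<noteq> b" "a \<noteq> c" "b \<noteq> c"
    and n: "shift X b (shift X c u0) \<noteq> 0" "shift X a (shift X c v0) \<noteq> 0"
      "shift X a (shift X b w0) \<noteq> 0"
  shows "X \<in> sim_class (J_diag a b c)"
proof -
  define u v w where "u = shift X b (shift X c u0)" "v = shift X a (shift X c v0)"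
    "w = shift X a (shift X b w0)"
  have "shift X a u = 0" "shift X b v = 0" "shift X c w = 0"
    by (simp_all add: u_v_w_def ann shift_commute[of X b a] shift_commute[of X c a]
      shift_commute[of X c b])
  moreover have "lin_indep3 u v w"
    unfolding lin_indep3_def
  proof (intro allI impI)
    fix x y z assume eq: "x *\<^sub>R u + y *\<^sub>R v + z *\<^sub>R w = 0"
    note eigen = shift_eigen[OF \<open>shift X a u = 0\<close>] shift_eigen[OF \<open>shift X b v = 0\<close>]
      shift_eigen[OF \<open>shift X c w = 0\<close>]
    have "shift X a (shift X b (x *\<^sub>R u + y *\<^sub>R v + z *\<^sub>R w)) = 0"
      by (simp only: eq shift_simps)
    then have "z = 0"
      using assms(2-4) n unfolding u_v_w_def[symmetric] by (simp add: shift_simps eigen)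
    have "x = 0 \<and> y = 0"
      by (rule lin_indep2_eigen[of a b u v X])
        (use eq \<open>z = 0\<close> assms(2) n \<open>shift X a u = 0\<close> \<open>shift X b v = 0\<close> in
          \<open>simp_all add: u_v_w_def[symmetric]\<close>)
    with \<open>z = 0\<close> show "x = 0 \<and> y = 0 \<and> z = 0" by simp
  qed
  ultimately show ?thesis by (intro similar_J_diag)
qed

text \<open>
  The vector $(X - b I) v_0$ and its image under $X - a I$ form the Jordan chain
  of $a$, and $(X - a I)^2 w_0$ is the eigenvector of $b$.
\<close>

lemma canonical_form_double:
  assumes ann: "\<And>v. shift X a (shift X a (shift X b v)) = 0" and "a \<noteq> b"
    and n: "shift X a (shift X b v0) \<noteq> 0" "shift X a (shift X a w0) \<noteq> 0"
  shows "X \<in> sim_class (J_one a b)"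
proof -
  define u v w where "u = shift X a (shift X b v0)" "v = shift X b v0"
    "w = shift X a (shift X a w0)"
  have u: "shift X a u = 0" and v: "shift X a v = u" and w: "shift X b w = 0"
    by (simp_all add: u_v_w_def ann shift_commute[of X b a])
  moreover have "lin_indep3 u v w"
    unfolding lin_indep3_def
  proof (intro allI impI)
    fix x y z assume eq: "x *\<^sub>R u + y *\<^sub>R v + z *\<^sub>R w = 0"
    have nz: "u \<noteq> 0" "w \<noteq> 0" using n by (simp_all add: u_v_w_def)
    have "shift X a (shift X a (x *\<^sub>R u + y *\<^sub>R v + z *\<^sub>R w)) = 0"
      by (simp only: eq shift_simps)
    then have z: "z = 0"
      using \<open>a \<noteq> b\<close> nz by (simp add: shift_simps u v shift_eigen[OF w])
    have "shift X a (x *\<^sub>R u + y *\<^sub>R v + z *\<^sub>R w) = 0"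
      by (simp only: eq shift_simps)
    then have "y = 0"
      using nz by (simp add: shift_simps u v z)
    with z eq nz show "x = 0 \<and> y = 0 \<and> z = 0" by simp
  qed
  ultimately show ?thesis by (intro similar_J_one)
qed

lemma canonical_form_triple:
  assumes ann: "\<And>v. shift X a (shift X a (shift X a v)) = 0"
    and n: "shift X a (shift X a w) \<noteq> 0"
  shows "X \<in> sim_class (J_two a)"
proof -
  have "lin_indep3 (shift X a (shift X a w)) (shift X a w) w"
    unfolding lin_indep3_def
  proof (intro allI impI)
    fix x y z assume eq: "x *\<^sub>R shift X a (shift X a w) + y *\<^sub>R shift X a w + z *\<^sub>R w = 0"
      (is "?e = 0")
    have "shift X a (shift X a ?e) = 0"
      by (simp only: eq shift_simps)
    then have z: "z = 0"
      using n by (simp add: shift_simps ann)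
    have "shift X a ?e = 0"
      by (simp only: eq shift_simps)
    then have "y = 0"
      using n by (simp add: shift_simps ann z)
    with z eq n show "x = 0 \<and> y = 0 \<and> z = 0" by simp
  qed
  then show ?thesis by (intro similar_J_two) (simp_all add: ann)
qed

text \<open>
  This is where the odd dimension enters: $Y^2 = -q^2 I$ in dimension three would imply
  $(\det Y)^2 = -q^6 < 0$.
\<close>

lemma square_not_negative_scalar:
  assumes "q \<noteq> 0"
  obtains v where "shift X p (shift X p v) + q\<^sup>2 *\<^sub>R v \<noteq> 0"
proof -
  have False if all: "\<And>v. shift X p (shift X p v) + q\<^sup>2 *\<^sub>R v = 0"
  proof -
    define Y where "Y = X - p *\<^sub>R mat 1"
    have Y: "Y *v v = shift X p v" for v
      by (simp add: Y_def shift_def matrix_vector_mult_diff_rdistrib flip: scaleR_matrix_vector_assoc)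
    have "(Y ** Y) *v v = (- (q\<^sup>2) *\<^sub>R mat 1) *v v" for v
    proof -
      have "(Y ** Y) *v v = - (q\<^sup>2) *\<^sub>R v"
        using all[of v] by (simp add: Y eq_neg_iff_add_eq_0 flip: matrix_vector_mul_assoc)
      also have "\<dots> = (- (q\<^sup>2) *\<^sub>R mat 1) *v v"
        by (simp only: scaleR_matrix_vector_assoc[symmetric] matrix_vector_mul_lid)
      finally show ?thesis .
    qed
    then have "Y ** Y = - (q\<^sup>2) *\<^sub>R mat 1"
      using matrix_eq by blast
    then have "det Y * det Y = det (- (q\<^sup>2) *\<^sub>R (mat 1 :: real^3^3))"
      by (metis det_mul)
    also have "\<dots> = - (q ^ 6)"
      by (simp add: det_3 mat_def power2_eq_square eval_nat_numeral)
    finally have "det Y * det Y < 0"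
      using assms by (simp add: zero_less_power_eq)
    then show False by (simp add: not_square_less_zero)
  qed
  then show ?thesis using that by blast
qed

text \<open>
  The quadratic factor applied to some vector gives an eigenvector $u$ of $a$, and $X - a I$ applied to
  another gives a vector $v$ killed by the quadratic factor. On the span of $v$ and
  $w = -(X - p I) v / q$ the operator $(X - p I) / q$ acts as a rotation by a right angle, as
  the lower block of the canonical form does.
\<close>

lemma canonical_form_complex:
  assumes ann: "\<And>v. shift X a (shift X p (shift X p v) + q\<^sup>2 *\<^sub>R v) = 0" and "q \<noteq> 0"
    and n: "shift X a w0 \<noteq> 0"
  shows "X \<in> sim_class (J_cplx a p q)"
proof -
  obtain u0 where u0: "shift X p (shift X p u0) + q\<^sup>2 *\<^sub>R u0 \<noteq> 0"
    using square_not_negative_scalar[OF \<open>q \<noteq> 0\<close>] by blast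
  define u v w where "u = shift X p (shift X p u0) + q\<^sup>2 *\<^sub>R u0" "v = shift X a w0"
    "w = (- 1 / q) *\<^sub>R shift X p v"
  have nz: "u \<noteq> 0" "v \<noteq> 0" using u0 n by (simp_all add: u_v_w_def)
  have u: "shift X a u = 0" using ann by (simp add: u_v_w_def)
  have v: "shift X p v = - q *\<^sub>R w" using \<open>q \<noteq> 0\<close> by (simp add: u_v_w_def)
  have "shift X p (shift X p v) + q\<^sup>2 *\<^sub>R v = shift X a (shift X p (shift X p w0) + q\<^sup>2 *\<^sub>R w0)"
    by (simp add: u_v_w_def shift_simps shift_commute[of X a])
  then have vv: "shift X p (shift X p v) = - (q\<^sup>2) *\<^sub>R v"
    by (simp add: ann eq_neg_iff_add_eq_0)
  have w: "shift X p w = q *\<^sub>R v"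
    using \<open>q \<noteq> 0\<close> by (simp add: u_v_w_def(3) shift_simps shift_minus vv power2_eq_square)
  have "lin_indep3 u v w"
    unfolding lin_indep3_def
  proof (intro allI impI)
    fix x y z assume eq: "x *\<^sub>R u + y *\<^sub>R v + z *\<^sub>R w = 0"
    \<comment> \<open>The quadratic factor kills \<open>v\<close> and \<open>w\<close> but multiplies \<open>u\<close> by a nonzero number.\<close>
    let ?Q = "\<lambda>e. shift X p (shift X p e) + q\<^sup>2 *\<^sub>R e"
    have "?Q v = 0" "?Q w = 0"
      by (simp_all add: shift_simps shift_minus v w power2_eq_square)
    moreover have "?Q u = ((a - p)\<^sup>2 + q\<^sup>2) *\<^sub>R u"
      by (simp add: shift_eigen[OF u] shift_simps power2_eq_square scaleR_add_left)
    moreover have "?Q (x *\<^sub>R u + y *\<^sub>R v + z *\<^sub>R w) = x *\<^sub>R ?Q u + y *\<^sub>R ?Q v + z *\<^sub>R ?Q w"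
      by (simp add: shift_simps algebra_simps)
    ultimately have "(x * ((a - p)\<^sup>2 + q\<^sup>2)) *\<^sub>R u = 0"
      by (simp add: eq shift_simps)
    then have x: "x = 0"
      using nz \<open>q \<noteq> 0\<close> by (simp add: sum_power2_eq_zero_iff)
    then have yz: "y *\<^sub>R v + z *\<^sub>R w = 0" using eq by simp
    then have "shift X p (y *\<^sub>R v + z *\<^sub>R w) = 0" by (simp add: shift_simps)
    then have "q *\<^sub>R (z *\<^sub>R v - y *\<^sub>R w) = 0"
      by (simp add: shift_simps v w algebra_simps)
    then have zy: "z *\<^sub>R v - y *\<^sub>R w = 0" using \<open>q \<noteq> 0\<close> by simp
    \<comment> \<open>A nontrivial relation between \<open>v\<close> and \<open>w\<close> rotates to a second one, and together they give \<open>v = 0\<close>.\<close>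
    have "(y\<^sup>2 + z\<^sup>2) *\<^sub>R v = y *\<^sub>R (y *\<^sub>R v + z *\<^sub>R w) + z *\<^sub>R (z *\<^sub>R v - y *\<^sub>R w)"
      by (simp add: algebra_simps power2_eq_square)
    then have "(y\<^sup>2 + z\<^sup>2) *\<^sub>R v = 0" by (simp only: yz zy) simp
    then show "x = 0 \<and> y = 0 \<and> z = 0"
      using nz x by (simp add: sum_power2_eq_zero_iff)
  qed
  then show ?thesis
    by (rule similar_J_cplx[OF _ u v w])
qed

section \<open>Existence of the canonical form\<close>

lemma cayley_hamilton_3:
  fixes X :: "real^3^3"
  obtains t s d where "\<And>v. X *v (X *v (X *v v)) - t *\<^sub>R (X *v (X *v v)) + s *\<^sub>R (X *v v) - d *\<^sub>R v = 0"
proof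
  fix v
  show "X *v (X *v (X *v v)) - (X$1$1 + X$2$2 + X$3$3) *\<^sub>R (X *v (X *v v)) +
     (X$1$1 * X$2$2 - X$1$2 * X$2$1 + X$1$1 * X$3$3 - X$1$3 * X$3$1 + X$2$2 * X$3$3 - X$2$3 * X$3$2)
       *\<^sub>R (X *v v) - det X *\<^sub>R v = 0"
    by (simp add: vec_eq_iff forall_3 matrix_vector_mult_def sum_3 det_3 algebra_simps)
qed

text \<open>
  The intermediate value theorem gives a real root, and the discriminant of the remaining quadratic
  factor decides between the two cases. The factorisation is stated through Vieta's formulas
  because it is applied to an operator, not to a number.
\<close>

lemma cubic_factors:
  fixes t s d :: real
  obtains (real) a b c where "t = a + b + c" "s = a * b + a * c + b * c" "d = a * b * c"
  | (cplx) a p q where "q > 0" "t = a + 2 * p" "s = 2 * a * p + p\<^sup>2 + q\<^sup>2"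
      "d = a * (p\<^sup>2 + q\<^sup>2)"
proof -
  define g where "g = (\<lambda>x::real. x ^ 3 - t * x\<^sup>2 + s * x - d)"
  define M where "M = 1 + \<bar>t\<bar> + \<bar>s\<bar> + \<bar>d\<bar>"
  have M: "M \<ge> 1" by (simp add: M_def)
  \<comment> \<open>At \<open>M\<close> and \<open>- M\<close> the cubic term dominates the others, so that \<open>g\<close> changes its sign between them.\<close>
  have bound: "\<bar>t\<bar> * M\<^sup>2 + \<bar>s\<bar> * M + \<bar>d\<bar> \<le> M ^ 3"
  proof -
    have "M \<le> M\<^sup>2" "1 \<le> M\<^sup>2"
      using M by (simp_all add: power2_eq_square mult_left_mono[of 1 M M, simplified] mult_ge1_I)
    then have "\<bar>s\<bar> * M \<le> \<bar>s\<bar> * M\<^sup>2" "\<bar>d\<bar> * 1 \<le> \<bar>d\<bar> * M\<^sup>2"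
      by (intro mult_left_mono; simp)+
    then have "\<bar>t\<bar> * M\<^sup>2 + \<bar>s\<bar> * M + \<bar>d\<bar> \<le> (M - 1) * M\<^sup>2"
      by (simp add: M_def algebra_simps)
    also have "\<dots> \<le> M ^ 3"
      by (simp add: power3_eq_cube power2_eq_square algebra_simps)
    finally show ?thesis .
  qed
  have "t * M\<^sup>2 \<le> \<bar>t\<bar> * M\<^sup>2" "(- t) * M\<^sup>2 \<le> \<bar>t\<bar> * M\<^sup>2" "(- s) * M \<le> \<bar>s\<bar> * M"
    using M by (intro mult_right_mono; simp)+
  then have "g (- M) \<le> 0" "0 \<le> g M"
    using bound unfolding g_def by (auto simp: power3_eq_cube)
  then obtain a where "g a = 0"
    using IVT[of g "- M" 0 M] M unfolding g_def by (auto intro!: continuous_intros)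
  define u where "u = t - a"
  define w where "w = s - a * u"
  have tsd: "t = a + u" "s = a * u + w" "d = a * w"
    using \<open>g a = 0\<close> unfolding g_def u_def w_def
    by (simp_all add: power3_eq_cube power2_eq_square algebra_simps)
  define D where "D = u\<^sup>2 - 4 * w"
  show thesis
  proof (cases "D \<ge> 0")
    case True
    define r where "r = sqrt D"
    have "r\<^sup>2 = u\<^sup>2 - 4 * w" using True by (simp add: r_def D_def)
    then have "(u + r) / 2 * ((u - r) / 2) = w"
      by (simp add: power2_eq_square field_simps)
    with tsd show thesis
      by (intro real[of a "(u + r) / 2" "(u - r) / 2"]) (auto simp: algebra_simps add_divide_distrib diff_divide_distrib)
  next
    case False
    define q where "q = sqrt (- D) / 2"
    have "q > 0" using False by (simp add: q_def)
    moreover have "(u / 2)\<^sup>2 + q\<^sup>2 = w"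
      using False by (simp add: q_def D_def power_divide field_simps)
    ultimately show thesis
      using tsd by (intro cplx[of q a "u / 2"]) (auto simp: algebra_simps)
  qed
qed

text \<open>
  The case distinction is by the least degree of an annihilating product of real linear
  factors, as far as it is at most two; excluding these degrees supplies the nonzero
  vectors that the cubic cases require.
\<close>

lemma exists_canonical_form:
  fixes X :: "real^3^3"
  shows "\<exists>i J m. canonical i J m \<and> X \<in> sim_class J"
proof -
  consider (scalar) "\<exists>a. \<forall>v. shift X a v = 0"
    | (quadratic) "\<exists>a b. \<forall>v. shift X a (shift X b v) = 0" "\<nexists>a. \<forall>v. shift X a v = 0"
    | (cubic) "\<nexists>a b. \<forall>v. shift X a (shift X b v) = 0"
    by blast
  then show ?thesis
  proof cases
    case scalar
    then obtain a where "\<And>v. shift X a v = 0" by blast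
    moreover have "lin_indep3 (axis 1 1) (axis 2 1) (axis 3 1)"
      by (simp add: lin_indep3_def vec_eq_iff forall_3 axis_def)
    ultimately have "X \<in> sim_class (J_diag a a a)"
      by (intro similar_J_diag)
    then show ?thesis using canonical4 by blast
  next
    case quadratic
    then obtain a b where ann: "\<And>v. shift X a (shift X b v) = 0" by blast
    obtain v w where n: "shift X a v \<noteq> 0" "shift X b w \<noteq> 0"
      using quadratic(2) by blast
    show ?thesis
    proof (cases "a = b")
      case True
      have "X \<in> sim_class (J_one a a)"
        by (rule canonical_form_square_zero[OF _ n(1)]) (use ann True in simp)
      then show ?thesis using canonical5 by blast
    next
      case False
      have "X \<in> sim_class (J_diag a a b) \<or> X \<in> sim_class (J_diag b b a)"
        by (rule canonical_form_split_quadratic[OF ann False n])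
      then show ?thesis
        using canonical2[OF False] canonical2[OF False[symmetric]] by blast
    qed
  next
    case cubic
    obtain t s d where ch:
      "\<And>v. X *v (X *v (X *v v)) - t *\<^sub>R (X *v (X *v v)) + s *\<^sub>R (X *v v) - d *\<^sub>R v = 0"
      using cayley_hamilton_3 by blast
    show ?thesis
    proof (cases t s d rule: cubic_factors)
      case (real a b c)
      have "shift X a (shift X b (shift X c v)) =
          X *v (X *v (X *v v)) - t *\<^sub>R (X *v (X *v v)) + s *\<^sub>R (X *v v) - d *\<^sub>R v" for v
        unfolding real shift_def matrix_vector_mult_diff_distrib matrix_vector_mult_scaleR
        by (simp add: vec_eq_iff algebra_simps)
      then have ann: "shift X a (shift X b (shift X c v)) = 0" for v
        using ch by simp
      obtain vab vac vbc where n: "shift X a (shift X b vab) \<noteq> 0"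
        "shift X a (shift X c vac) \<noteq> 0" "shift X b (shift X c vbc) \<noteq> 0"
        using cubic by blast
      obtain vaa vbb where nn: "shift X a (shift X a vaa) \<noteq> 0" "shift X b (shift X b vbb) \<noteq> 0"
        using cubic by blast
      consider "a \<noteq> b" "a \<noteq> c" "b \<noteq> c" | "a = b" "b = c" | "a = b" "b \<noteq> c"
        | "a = c" "c \<noteq> b" | "b = c" "c \<noteq> a"
        by blast
      then show ?thesis
      proof cases
        case 1
        have "X \<in> sim_class (J_diag a b c)"
          by (rule canonical_form_distinct[OF ann 1 n(3,2,1)])
        then show ?thesis using canonical1[OF 1] by blast
      next
        case 2
        have "X \<in> sim_class (J_two a)"
          by (rule canonical_form_triple[OF _ nn(1)]) (use ann 2 in simp)
        then show ?thesis using canonical6 by blast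
      next
        case 3
        have "X \<in> sim_class (J_one a c)"
          by (rule canonical_form_double[OF _ _ n(2) nn(1)]) (use ann 3 in simp_all)
        then show ?thesis using canonical3[of a c] 3 by blast
      next
        case 4
        have "shift X a (shift X a (shift X b v)) = 0" for v
          using ann[of v] 4 by (simp add: shift_commute[of X b c])
        then have "X \<in> sim_class (J_one a b)"
          by (rule canonical_form_double[OF _ _ n(1) nn(1)]) (use 4 in simp)
        then show ?thesis using canonical3[of a b] 4 by blast
      next
        case 5
        have ba: "shift X b (shift X b (shift X a v)) = 0" for v
          using ann[of v] 5 by (simp add: shift_commute[of X a c])
        have "shift X b (shift X a vab) \<noteq> 0"
          using n(1) by (simp add: shift_commute[of X b a])
        then have "X \<in> sim_class (J_one b a)"
          by (intro canonical_form_double[OF ba _ _ nn(2)]) (use 5 in simp_all)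
        then show ?thesis using canonical3[of b a] 5 by blast
      qed
    next
      case (cplx a p q)
      have "shift X a (shift X p (shift X p v) + q\<^sup>2 *\<^sub>R v) =
          X *v (X *v (X *v v)) - t *\<^sub>R (X *v (X *v v)) + s *\<^sub>R (X *v v) - d *\<^sub>R v" for v
        unfolding cplx shift_def matrix_vector_mult_diff_distrib matrix_vector_right_distrib
          matrix_vector_mult_scaleR
        by (simp add: vec_eq_iff algebra_simps power2_eq_square)
      then have "shift X a (shift X p (shift X p v) + q\<^sup>2 *\<^sub>R v) = 0" for v
        using ch by simp
      moreover have "\<exists>w. shift X a w \<noteq> 0"
        using cubic by blast
      ultimately have "X \<in> sim_class (J_cplx a p q)"
        using canonical_form_complex[of X a p q] cplx(1) by auto
      then show ?thesis using canonical7 cplx(1) by blast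
    qed
  qed
qed

section \<open>Classification of the solutions\<close>

theorem theorem4p5:
  fixes n :: nat and a :: "nat \<Rightarrow> real" and f :: "real poly" and S :: "(real^3^3) set"
  assumes "n \<ge> 1"
  defines "f \<equiv> monic_poly n a"
    and "S \<equiv> {X. matpow X n + (\<Sum>k<n. a k *\<^sub>R matpow X k) = 0}"
  shows "(S = {} \<and> listed_classes f = {}) \<or>
    (listed_classes f \<noteq> {} \<and> S = (\<Union>d\<in>listed_classes f. snd d) \<and>
      disjoint_family_on snd (listed_classes f))"
proof -
  have listed: "listed_classes f = {(i, sim_class J) | i J. \<exists>m. canonical i J m \<and> m dvd f}"
    by (rule listed_classes_eq) (simp add: f_def monic_poly_nonzero)
  have S: "X \<in> S \<longleftrightarrow> mat_poly f X = 0" for X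
    by (simp add: S_def f_def mat_poly_monic_poly)
  have union: "S = (\<Union>d\<in>listed_classes f. snd d)"
  proof (intro equalityI subsetI)
    fix X assume "X \<in> S"
    obtain i J m where J: "canonical i J m" "X \<in> sim_class J"
      using exists_canonical_form by blast
    then have "m dvd f"
      using \<open>X \<in> S\<close> S canonical_annihilator mat_poly_similar_zero by blast
    with J(1) have "(i, sim_class J) \<in> listed_classes f"
      unfolding listed by blast
    with J(2) show "X \<in> (\<Union>d\<in>listed_classes f. snd d)" by force
  next
    fix X assume "X \<in> (\<Union>d\<in>listed_classes f. snd d)"
    then obtain i J m where "canonical i J m" "m dvd f" "X \<in> sim_class J"
      unfolding listed by auto
    then show "X \<in> S"
      using S canonical_annihilator mat_poly_similar_zero by blast
  qed
  moreover have "disjoint_family_on snd (listed_classes f)"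
    unfolding disjoint_family_on_def
  proof (intro ballI impI)
    fix d e assume "d \<in> listed_classes f" "e \<in> listed_classes f" "d \<noteq> e"
    then obtain i J m j J' m' where
      d: "d = (i, sim_class J)" "canonical i J m" and e: "e = (j, sim_class J')" "canonical j J' m'"
      unfolding listed by blast
    show "snd d \<inter> snd e = {}"
    proof (rule ccontr)
      assume "snd d \<inter> snd e \<noteq> {}"
      then obtain X where X: "X \<in> sim_class J" "X \<in> sim_class J'"
        by (auto simp: d e)
      then have "i = j" "sim_class J = sim_class J'"
        using canonical_class_kind_unique[OF d(2) e(2)] sim_class_eqI by blast+
      with \<open>d \<noteq> e\<close> show False by (simp add: d e)
    qed
  qed
  ultimately show ?thesis by blast
qed

end
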